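(* Let $\mathcal{D}=(S,P,L)$ be a labelled Markov chain, let $\{S_1,\dots,S_m\}$ be a label-preserving partition of $S$, fix $i\in\{1,\dots,m\}$ and write $S_i=\{s_1^i,\dots,s_{n_i}^i\}$. For $1\le j\le n_i$ let $r_j^i=(P(s_j^i,S_1),\dots,P(s_j^i,S_m))\in\mathbb{R}^m$, and for $1\le l\le m$ let $$u_l^i=\min_{1\le j\le n_i}(r_j^i)_l,\qquad v_l^i=\max_{1\le j\le n_i}(r_j^i)_l .$$ Let $$\beta_i=\tfrac12\max_{1\le j\le n_i}\ \max_{1\le \ell\le n_i,\ \ell\neq j}\Vert r_j^i-r_\ell^i\Vert_\infty .$$ Then the family of stochastic vectors $r^i\in\mathbb{R}^m$ such that $\max_{1\le j\le n_i}\Vert r^i-r_j^i\Vert_\infty=\beta_i$ is exactly the transition set $$[u^i,v^i]_{\mathrm{opt}}=\big([v_1^i-\beta_i,\,u_1^i+\beta_i],\dots,[v_m^i-\beta_i,\,u_m^i+\beta_i]\big).$$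
   Context: A labelled Markov chain (LMC) is a tuple $(S,P,L)$ where $S$ is a non-empty finite set of states, $P:S\times S\to[0,1]$ is a transition probability matrix (each row sums to $1$), and $L:S\to 2^{\mathrm{AP}}$ is a labelling function, with $\mathrm{AP}$ a fixed set of atomic propositions. For $s\in S$ and $Q\subseteq S$, $P(s,Q)=\sum_{q\in Q}P(s,q)$. A partition $\{S_1,\dots,S_m\}$ of $S$ into non-empty sets is label-preserving if $L(s)=L(s')$ whenever $s,s'$ lie in the same $S_i$. $(x)_l$ denotes the $l$-th component of a vector $x$, and $\Vert\cdot\Vert_\infty$ is the maximum norm. A vector in $\mathbb{R}^m$ is stochastic if its entries are non-negative and sum to $1$. The transition set written $([a_1,b_1],\dots,[a_m,b_m])$ is the (possibly empty) set of all stochastic vectors $x\in\mathbb{R}^m$ with $a_l\le x_l\le b_l$ for all $1\le l\le m$. A maximum over an empty index set (case $n_i=1$) is taken to be $0$. *)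

theory Defs
  imports "HOL-Analysis.Analysis" "HOL-Library.Disjoint_Sets"
begin

locale labelled_markov_chain =
  fixes AP :: "'ap set"
    and S :: "'s set"
    and P :: "'s \<Rightarrow> 's \<Rightarrow> real"
    and L :: "'s \<Rightarrow> 'ap set"
  assumes finite_states: "finite S"
    and states_nonempty: "S \<noteq> {}"
    and prob_range: "\<lbrakk>s \<in> S; t \<in> S\<rbrakk> \<Longrightarrow> P s t \<in> {0..1}"
    and row_sum: "s \<in> S \<Longrightarrow> (\<Sum>t\<in>S. P s t) = 1"
    and label_subset: "s \<in> S \<Longrightarrow> L s \<subseteq> AP"

definition prob_into :: "('s \<Rightarrow> 's \<Rightarrow> real) \<Rightarrow> 's \<Rightarrow> 's set \<Rightarrow> real" where
  "prob_into P s Q = (\<Sum>q\<in>Q. P s q)"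

definition label_preserving_partition :: "'s set \<Rightarrow> ('s \<Rightarrow> 'ap set) \<Rightarrow> 's set set \<Rightarrow> bool" where
  "label_preserving_partition S L X \<longleftrightarrow>
     partition_on S X \<and> (\<forall>B\<in>X. \<forall>s\<in>B. \<forall>s'\<in>B. L s = L s')"

definition stochastic_vec :: "real ^ 'm::finite \<Rightarrow> bool" where
  "stochastic_vec x \<longleftrightarrow> (\<forall>l. 0 \<le> x $ l) \<and> (\<Sum>l\<in>UNIV. x $ l) = 1"

definition transition_set :: "real ^ 'm::finite \<Rightarrow> real ^ 'm \<Rightarrow> (real ^ 'm) set" where
  "transition_set a b = {x. stochastic_vec x \<and> (\<forall>l. a $ l \<le> x $ l \<and> x $ l \<le> b $ l)}"

text \<open>The value 0 on the empty set is needed because \<open>Max {}\<close> is unspecified.\<close>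

definition Max0 :: "real set \<Rightarrow> real" where
  "Max0 A = (if A = {} then 0 else Max A)"

end

(* The ball of radius Max_j |x - r_j| around x contains all r_j, so by the triangle
   inequality any two of the r_j have distance at most twice this radius.  Hence the maximum is
   never smaller than beta, and it equals beta iff it is at most beta, which, read coordinatewise
   in the maximum norm, is the interval condition. *)
theory Submission
  imports Defs
begin

text \<open>Passes from the maximum norm to single coordinates, where the interval bounds of the
  transition set live.\<close>

lemma infnorm_le_iff_cart:
  fixes x :: "real ^ 'm::finite"
  shows "infnorm x \<le> c \<longleftrightarrow> (\<forall>l. \<bar>x $ l\<bar> \<le> c)"
proof
  assume "infnorm x \<le> c"
  then show "\<forall>l. \<bar>x $ l\<bar> \<le> c"
    using component_le_infnorm_cart order_trans by blast
next
  assume "\<forall>l. \<bar>x $ l\<bar> \<le> c"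
  then show "infnorm x \<le> c"
    \<comment> \<open>\<open>cSup_least\<close> asks for a nonempty set of values; it is nonempty
      because the index type is inhabited.\<close>
    unfolding infnorm_cart by (auto intro!: cSup_least)
qed

lemma half_diameter_le_radius:
  fixes r :: "'i \<Rightarrow> 'a::euclidean_space"
  assumes "finite J" "J \<noteq> {}"
  shows "1 / 2 * (MAX j\<in>J. Max0 ((\<lambda>k. infnorm (r j - r k)) ` (J - {j})))
    \<le> (MAX j\<in>J. infnorm (x - r j))"
proof -
  let ?R = "MAX j\<in>J. infnorm (x - r j)"
  have near: "infnorm (x - r j) \<le> ?R" if "j \<in> J" for j
    using assms that by simp
  obtain j0 where "j0 \<in> J" using assms by blast
  then have nonneg: "0 \<le> ?R"
    using near infnorm_pos_le order_trans by blast
  have dist: "infnorm (r j - r k) \<le> 2 * ?R" if "j \<in> J" "k \<in> J" for j k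
  proof -
    \<comment> \<open>Route the difference through the centre \<open>x\<close>.\<close>
    have "infnorm (r j - r k) = infnorm ((x - r k) + - (x - r j))" by simp
    also have "\<dots> \<le> infnorm (x - r k) + infnorm (x - r j)"
      by (metis infnorm_neg infnorm_triangle)
    finally show ?thesis using near[OF that(1)] near[OF that(2)] by linarith
  qed
  \<comment> \<open>If \<open>J = {j}\<close>, the inner maximum is the default 0;
    \<open>nonneg\<close> covers this case, \<open>dist\<close> all others.\<close>
  have "Max0 ((\<lambda>k. infnorm (r j - r k)) ` (J - {j})) \<le> 2 * ?R" if "j \<in> J" for j
    unfolding Max0_def using assms that nonneg dist by auto
  then have "(MAX j\<in>J. Max0 ((\<lambda>k. infnorm (r j - r k)) ` (J - {j}))) \<le> 2 * ?R"
    using assms by simp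
  then show ?thesis by linarith
qed

lemma radius_eq_half_diameter_iff:
  fixes r :: "'i \<Rightarrow> real ^ 'm::finite"
  assumes "finite J" "J \<noteq> {}"
    and "\<beta> = 1 / 2 * (MAX j\<in>J. Max0 ((\<lambda>k. infnorm (r j - r k)) ` (J - {j})))"
  shows "(MAX j\<in>J. infnorm (x - r j)) = \<beta> \<longleftrightarrow>
    (\<forall>l. (MAX j\<in>J. r j $ l) - \<beta> \<le> x $ l \<and> x $ l \<le> (MIN j\<in>J. r j $ l) + \<beta>)"
proof -
  have "(MAX j\<in>J. infnorm (x - r j)) = \<beta> \<longleftrightarrow> (MAX j\<in>J. infnorm (x - r j)) \<le> \<beta>"
    using half_diameter_le_radius[OF assms(1,2), of r x] assms(3) by linarith
  also have "\<dots> \<longleftrightarrow> (\<forall>j\<in>J. \<forall>l. \<bar>x $ l - r j $ l\<bar> \<le> \<beta>)"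
    using assms(1,2) by (simp add: infnorm_le_iff_cart)
  \<comment> \<open>Swapping the quantifiers and isolating \<open>r j $ l\<close> leaves bounds free
    of \<open>j\<close>, so the upper bounds merge into one on the maximum and the lower ones into
    one on the minimum.\<close>
  also have "\<dots> \<longleftrightarrow> (\<forall>l. (\<forall>j\<in>J. r j $ l \<le> x $ l + \<beta>) \<and> (\<forall>j\<in>J. x $ l - \<beta> \<le> r j $ l))"
    by (auto simp: abs_le_iff algebra_simps)
  also have "\<dots> \<longleftrightarrow> (\<forall>l. (MAX j\<in>J. r j $ l) \<le> x $ l + \<beta> \<and> x $ l - \<beta> \<le> (MIN j\<in>J. r j $ l))"
    using assms(1,2) by simp
  finally show ?thesis by (simp add: algebra_simps)
qed

theorem proposition1:
  fixes AP :: "'ap set"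
    and S :: "'s set"
    and P :: "'s \<Rightarrow> 's \<Rightarrow> real"
    and L :: "'s \<Rightarrow> 'ap set"
    and B :: "'m::finite \<Rightarrow> 's set"
    and i :: 'm
    and n :: nat
    and s :: "nat \<Rightarrow> 's"
    and r :: "nat \<Rightarrow> real ^ 'm"
    and u v :: "real ^ 'm"
    and \<beta> :: real
  assumes "labelled_markov_chain AP S P L"
    and "inj B"
    and "label_preserving_partition S L (range B)"
    and "bij_betw s {1..n} (B i)"
    and "\<And>j. j \<in> {1..n} \<Longrightarrow> r j = (\<chi> l. prob_into P (s j) (B l))"
    and "u = (\<chi> l. MIN j\<in>{1..n}. r j $ l)"
    and "v = (\<chi> l. MAX j\<in>{1..n}. r j $ l)"
    and "\<beta> = 1 / 2 * (MAX j\<in>{1..n}. Max0 ((\<lambda>k. infnorm (r j - r k)) ` ({1..n} - {j})))"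
  shows "{x. stochastic_vec x \<and> (MAX j\<in>{1..n}. infnorm (x - r j)) = \<beta>}
       = transition_set (\<chi> l. v $ l - \<beta>) (\<chi> l. u $ l + \<beta>)"
proof -
  \<comment> \<open>Blocks of a partition are nonempty, so the extrema over \<open>{1..n}\<close>
    are taken over a nonempty set.\<close>
  have "B i \<noteq> {}"
    using assms(3) unfolding label_preserving_partition_def partition_on_def by blast
  then have ne: "{1..n} \<noteq> {}"
    using assms(4) by (auto simp: bij_betw_def)
  \<comment> \<open>Both sets demand \<open>stochastic_vec x\<close>; the equivalence rewrites the
    remaining condition, after which the two sides coincide literally.\<close>
  show ?thesis
    unfolding transition_set_def assms(6,7) vec_lambda_beta
      radius_eq_half_diameter_iff[OF finite_atLeastAtMost ne assms(8)] ..
qed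

end
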